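(* Let $X_0$ be a Banach space and let $(T_0(t))_{t\geqslant 0}$ be a $C_0$-semigroup on $X_0$ with generator $A_0$ such that $0\in\rho(A_0)$. For $n\geqslant 1$ let $X_n$ be the interpolation space of order $n$ associated with $T_0$, with restricted semigroup $T_n$ and generator $A_n$. Let $X_\infty=\operatorname{proj}_{n\in\mathbb{N}}X_n$ be the projective limit of all interpolation spaces. Then $X_\infty$ is a Fréchet space. The semigroups $T_n$ induce a strongly continuous semigroup $T_\infty=(T_\infty(t))_{t\geqslant 0}$ on $X_\infty$ whose generator $A_\infty$ is defined on all of $X_\infty$ and $A_\infty\colon X_\infty\to X_\infty$ is an isomorphism (linear homeomorphism). For every $t\geqslant 0$ and every $n\geqslant 1$ the map $T_\infty(t)$ is a restriction of $T_n(t)$ and the map $A_\infty$ is a restriction of $A_n$.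
   Context: Interpolation spaces: for $n\geqslant 1$ put $\|x\|_n=\|A_0^nx\|_0$ for $x\in D(A_0^n)$ and $X_n=(D(A_0^n),\|\cdot\|_n)$. For $t\geqslant 0$, $T_n(t)$ is the restriction of $T_0(t)$ to $X_n$; $(T_n(t))_{t\geqslant 0}$ is a $C_0$-semigroup on $X_n$ and $A_n$ denotes its generator. The projective limit $\operatorname{proj}_{n\in\mathbb{N}}X_n$ is the intersection $X_\infty=\bigcap_{n\in\mathbb{N}}X_n$ endowed with the coarsest topology making all inclusions $X_\infty\to X_n$ continuous. $T_\infty(t)$ is the restriction of the maps $T_n(t)$ to $X_\infty$; this is the meaning of "induce". A strongly continuous semigroup on a locally convex space $Y$ is a map $T\colon[0,\infty)\to L(Y)$ (continuous linear operators) with $T(0)=I$, $T(t+s)=T(t)T(s)$, and $t\mapsto T(t)x$ continuous for every $x\in Y$; its generator is $Gx=\lim_{t\searrow 0}\frac{T(t)x-x}{t}$ on the set of those $x\in Y$ for which the limit exists. *)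

theory Defs
  imports "HOL-Analysis.Analysis"
begin

text \<open>
  Real and complex Banach spaces are treated together: the scalars are an arbitrary
  \<open>real_normed_field\<close> (up to isomorphism the reals or the complex numbers), acting on
  a type of class \<open>real_normed_vector\<close> or \<open>banach\<close> compatibly with the built-in real scalar
  multiplication.
\<close>

locale normed_space_over = vector_space smul
  for smul :: "'k::real_normed_field \<Rightarrow> 'a::real_normed_vector \<Rightarrow> 'a" +
  assumes norm_smul: "norm (smul c x) = norm c * norm x"
    and smul_of_real: "smul (of_real r) x = r *\<^sub>R x"

text \<open>
  A topological vector space is represented by a topology whose carrier \<open>topspace \<tau>\<close> is a
  linear subspace of the ambient type; maps on it are total functions of which only the
  values on the carrier matter.
\<close>

definition topological_vector_space_on ::
    "('k::real_normed_field \<Rightarrow> 'a::real_vector \<Rightarrow> 'a) \<Rightarrow> 'a topology \<Rightarrow> bool" where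
  "topological_vector_space_on smul \<tau> \<longleftrightarrow>
     module.subspace smul (topspace \<tau>) \<and>
     continuous_map (prod_topology \<tau> \<tau>) \<tau> (\<lambda>(x, y). x + y) \<and>
     continuous_map (prod_topology euclidean \<tau>) \<tau> (\<lambda>(c, x). smul c x)"

definition locally_convex_space ::
    "('k::real_normed_field \<Rightarrow> 'a::real_vector \<Rightarrow> 'a) \<Rightarrow> 'a topology \<Rightarrow> bool" where
  "locally_convex_space smul \<tau> \<longleftrightarrow>
     topological_vector_space_on smul \<tau> \<and> Hausdorff_space \<tau> \<and>
     (\<forall>U. openin \<tau> U \<and> 0 \<in> U \<longrightarrow>
        (\<exists>V. openin \<tau> V \<and> 0 \<in> V \<and> convex V \<and> V \<subseteq> U))"

definition frechet_space ::
    "('k::real_normed_field \<Rightarrow> 'a::real_vector \<Rightarrow> 'a) \<Rightarrow> 'a topology \<Rightarrow> bool" where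
  "frechet_space smul \<tau> \<longleftrightarrow>
     locally_convex_space smul \<tau> \<and>
     (\<exists>d. Metric_space (topspace \<tau>) d \<and>
          (\<forall>x\<in>topspace \<tau>. \<forall>y\<in>topspace \<tau>. \<forall>z\<in>topspace \<tau>. d (x + z) (y + z) = d x y) \<and>
          Metric_space.mcomplete (topspace \<tau>) d \<and>
          Metric_space.mtopology (topspace \<tau>) d = \<tau>)"

definition continuous_linear_operators ::
    "('k::real_normed_field \<Rightarrow> 'a::real_vector \<Rightarrow> 'a) \<Rightarrow> 'a topology \<Rightarrow> ('a \<Rightarrow> 'a) set" where
  "continuous_linear_operators smul \<tau> =
     {f. continuous_map \<tau> \<tau> f \<and>
         (\<forall>x\<in>topspace \<tau>. \<forall>y\<in>topspace \<tau>. f (x + y) = f x + f y) \<and>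
         (\<forall>c. \<forall>x\<in>topspace \<tau>. f (smul c x) = smul c (f x))}"

text \<open>For \<open>\<tau> = euclidean\<close> on a Banach space this is the notion of a \<open>C\<^sub>0\<close>-semigroup.\<close>

definition strongly_continuous_semigroup ::
    "('k::real_normed_field \<Rightarrow> 'a::real_vector \<Rightarrow> 'a) \<Rightarrow> 'a topology \<Rightarrow>
     (real \<Rightarrow> 'a \<Rightarrow> 'a) \<Rightarrow> bool" where
  "strongly_continuous_semigroup smul \<tau> T \<longleftrightarrow>
     (\<forall>t\<ge>0. T t \<in> continuous_linear_operators smul \<tau>) \<and>
     (\<forall>x\<in>topspace \<tau>. T 0 x = x) \<and>
     (\<forall>t\<ge>0. \<forall>s\<ge>0. \<forall>x\<in>topspace \<tau>. T (t + s) x = T t (T s x)) \<and>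
     (\<forall>x\<in>topspace \<tau>. continuous_map (top_of_set {0..}) \<tau> (\<lambda>t. T t x))"

text \<open>
  Unbounded operators are given by a domain and a function; the function is only meaningful
  on the domain. The value of the generator is well defined when \<open>\<tau>\<close> is Hausdorff.
\<close>

definition generator_domain ::
    "'a::real_vector topology \<Rightarrow> (real \<Rightarrow> 'a \<Rightarrow> 'a) \<Rightarrow> 'a set" where
  "generator_domain \<tau> T =
     {x \<in> topspace \<tau>. \<exists>y. limitin \<tau> (\<lambda>t. (1 / t) *\<^sub>R (T t x - x)) y (at_right 0)}"

definition generator ::
    "'a::real_vector topology \<Rightarrow> (real \<Rightarrow> 'a \<Rightarrow> 'a) \<Rightarrow> 'a \<Rightarrow> 'a" where
  "generator \<tau> T x = (THE y. limitin \<tau> (\<lambda>t. (1 / t) *\<^sub>R (T t x - x)) y (at_right 0))"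

definition resolvent_set ::
    "('k::real_normed_field \<Rightarrow> 'a::real_normed_vector \<Rightarrow> 'a) \<Rightarrow> 'a set \<Rightarrow> ('a \<Rightarrow> 'a) \<Rightarrow> 'k set"
  where
  "resolvent_set smul D A =
     {c. bij_betw (\<lambda>x. smul c x - A x) D UNIV \<and>
         inv_into D (\<lambda>x. smul c x - A x) \<in> continuous_linear_operators smul euclidean}"

definition is_restriction_of :: "'a set \<Rightarrow> ('a \<Rightarrow> 'b) \<Rightarrow> 'a set \<Rightarrow> ('a \<Rightarrow> 'b) \<Rightarrow> bool" where
  "is_restriction_of D f E g \<longleftrightarrow> D \<subseteq> E \<and> (\<forall>x\<in>D. f x = g x)"

text \<open>
  The carrier of the \<open>n\<close>-th interpolation space is the domain of the \<open>n\<close>-th power of the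
  generator of \<open>T\<close>; for \<open>n = 0\<close> this gives the original Banach space with its norm.
\<close>

definition interpolation_space :: "(real \<Rightarrow> 'a::real_normed_vector \<Rightarrow> 'a) \<Rightarrow> nat \<Rightarrow> 'a set" where
  "interpolation_space T n =
     {x. \<forall>k<n. (generator euclidean T ^^ k) x \<in> generator_domain euclidean T}"

text \<open>
  The value \<open>0\<close> off the carrier is irrelevant; it serves to make the induced distance
  nonnegative and symmetric on the whole type, as the locale \<open>Metric_space\<close> requires.
\<close>

definition interpolation_norm ::
    "(real \<Rightarrow> 'a::real_normed_vector \<Rightarrow> 'a) \<Rightarrow> nat \<Rightarrow> 'a \<Rightarrow> real" where
  "interpolation_norm T n x =
     (if x \<in> interpolation_space T n then norm ((generator euclidean T ^^ n) x) else 0)"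

definition interpolation_topology ::
    "(real \<Rightarrow> 'a::real_normed_vector \<Rightarrow> 'a) \<Rightarrow> nat \<Rightarrow> 'a topology" where
  "interpolation_topology T n =
     Metric_space.mtopology (interpolation_space T n) (\<lambda>x y. interpolation_norm T n (x - y))"

definition interpolation_semigroup ::
    "(real \<Rightarrow> 'a::real_normed_vector \<Rightarrow> 'a) \<Rightarrow> nat \<Rightarrow> real \<Rightarrow> 'a \<Rightarrow> 'a" where
  "interpolation_semigroup T n t = restrict (T t) (interpolation_space T n)"

text \<open>
  The generating sets are the preimages of open sets under the inclusions of the
  intersection, so this is the coarsest topology making all inclusions continuous.
\<close>

definition projective_limit_topology :: "(nat \<Rightarrow> 'a topology) \<Rightarrow> 'a topology" where
  "projective_limit_topology \<tau> =
     topology_generated_by {(\<Inter>m. topspace (\<tau> m)) \<inter> U |n U. openin (\<tau> n) U}"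

definition limit_space :: "(real \<Rightarrow> 'a::real_normed_vector \<Rightarrow> 'a) \<Rightarrow> 'a set" where
  "limit_space T = (\<Inter>n. interpolation_space T n)"

definition limit_topology :: "(real \<Rightarrow> 'a::real_normed_vector \<Rightarrow> 'a) \<Rightarrow> 'a topology" where
  "limit_topology T = projective_limit_topology (interpolation_topology T)"

definition limit_semigroup ::
    "(real \<Rightarrow> 'a::real_normed_vector \<Rightarrow> 'a) \<Rightarrow> real \<Rightarrow> 'a \<Rightarrow> 'a" where
  "limit_semigroup T t = restrict (T t) (limit_space T)"

end

theory Submission
  imports Defs
begin

text \<open>
  Since \<open>0\<close> lies in the resolvent set, \<open>A = A\<^sub>0\<close> is a bijection of its domain onto the Banach space
  with a continuous inverse \<open>B\<close>, and both commute with the semigroup. Hence \<open>A\<^sup>n\<close> identifies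
  \<open>X\<^sub>n\<close> isometrically with \<open>X\<^sub>0\<close>, and \<open>\<Phi> x = (x, A x, A\<^sup>2 x, \<dots>)\<close> embeds
  \<open>X\<^sub>\<infinity>\<close> into the countable product of copies of \<open>X\<^sub>0\<close>. Its image is
  \<open>{h. \<forall>n. h n = B (h (n + 1))}\<close>, a closed set, so the complete translation-invariant metric
  of the product restricts to one on \<open>X\<^sub>\<infinity>\<close>. On \<open>\<Phi> X\<^sub>\<infinity>\<close> the operator \<open>A\<close> is the shift,
  while limits and continuity are decided coordinatewise, so the statements about the
  semigroup and its generator reduce to those on \<open>X\<^sub>0\<close>.
\<close>

section \<open>Pullback topologies: limits, projective limits, metrics and completeness\<close>

lemma limitin_pullback_topology:
  "limitin (pullback_topology S f X) g l F \<longleftrightarrow>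
     l \<in> S \<and> eventually (\<lambda>x. g x \<in> S) F \<and> limitin X (f \<circ> g) (f l) F"
proof
  assume L: "limitin (pullback_topology S f X) g l F"
  then have l: "l \<in> S" "f l \<in> topspace X"
    by (auto simp: limitin_def topspace_pullback_topology)
  have ev: "eventually (\<lambda>x. g x \<in> f -` U \<inter> S) F" if "openin X U" "f l \<in> U" for U
    using limitinD[OF L, of "f -` U \<inter> S"] that l by (auto simp: openin_pullback_topology)
  have "eventually (\<lambda>x. g x \<in> S) F"
    using ev[OF openin_topspace l(2)] by (rule eventually_mono) auto
  moreover have "eventually (\<lambda>x. (f \<circ> g) x \<in> U) F" if "openin X U" "f l \<in> U" for U
    using ev[OF that] by (rule eventually_mono) auto
  ultimately show "l \<in> S \<and> eventually (\<lambda>x. g x \<in> S) F \<and> limitin X (f \<circ> g) (f l) F"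
    using l by (auto simp: limitin_def)
next
  assume R: "l \<in> S \<and> eventually (\<lambda>x. g x \<in> S) F \<and> limitin X (f \<circ> g) (f l) F"
  have "eventually (\<lambda>x. g x \<in> f -` U \<inter> S) F" if "openin X U" "f l \<in> U" for U
    using R limitinD[of X "f \<circ> g" "f l" F U] that by (auto elim: eventually_elim2)
  then show "limitin (pullback_topology S f X) g l F"
    using R by (auto simp: limitin_def topspace_pullback_topology openin_pullback_topology)
qed

text \<open>Both sides are the coarsest topology for which every \<open>f n\<close> is continuous,
  because the product topology is itself coarsest for its projections. Hence the identity is
  continuous in both directions.\<close>

lemma projective_limit_topology_pullback:
  fixes f :: "nat \<Rightarrow> 'a \<Rightarrow> 'b::topological_space"
  shows "projective_limit_topology (\<lambda>n. pullback_topology (S n) (f n) euclidean) =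
         pullback_topology (\<Inter>n. S n) (\<lambda>x n. f n x) euclidean"
    (is "?P = ?Q")
proof -
  define \<G> where "\<G> = {(\<Inter>n. S n) \<inter> U |n U. openin (pullback_topology (S n) (f n) euclidean) U}"
  have P: "?P = topology_generated_by \<G>"
    by (simp add: projective_limit_topology_def \<G>_def topspace_pullback_topology)
  have G: "(\<Inter>n. S n) \<inter> f n -` V \<in> \<G>" if "open V" for n V
    unfolding \<G>_def openin_pullback_topology mem_Collect_eq
    using that by (intro exI[of _ n] exI[of _ "f n -` V \<inter> S n"]) auto
  \<comment> \<open>The choice \<open>V = UNIV\<close> makes the whole carrier a generating set, so
    the generated topology has the right \<open>topspace\<close>.\<close>
  have "(\<Inter>n. S n) \<in> \<G>"
    using G[of UNIV 0] by simp
  then have top: "\<Union>\<G> = (\<Inter>n. S n)"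
    by (auto simp: \<G>_def)
  have "openin ?Q W" if "W \<in> \<G>" for W
  proof -
    obtain n V where V: "open V" "W = (\<Inter>n. S n) \<inter> (f n -` V \<inter> S n)"
      using \<open>W \<in> \<G>\<close> by (auto simp: \<G>_def openin_pullback_topology)
    have "open ((\<lambda>h::nat \<Rightarrow> 'b. h n) -` V)"
      by (rule open_vimage[OF V(1)]) simp
    then show ?thesis
      unfolding openin_pullback_topology open_openin[symmetric]
      using V(2) by (intro exI[of _ "(\<lambda>h. h n) -` V"]) auto
  qed
  moreover have "openin ?Q (\<Inter>n. S n)"
    using openin_topspace[of ?Q] by (simp add: topspace_pullback_topology)
  ultimately have "continuous_map ?Q ?P id"
    unfolding P
    by (intro continuous_on_generated_topo)
      (simp_all add: top topspace_pullback_topology openin_Int)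
  moreover have "continuous_map ?P ?Q id"
  proof (rule continuous_map_pullback')
    have "continuous_map ?P euclidean (f n)" for n
      unfolding P continuous_map_alt topology_generated_by_topspace top
      using G by (auto simp: Int_commute intro: topology_generated_by_Basis)
    then show "continuous_map ?P euclidean ((\<lambda>x n. f n x) \<circ> id)"
      by (simp flip: euclidean_product_topology add: continuous_map_componentwise_UNIV)
    show "topspace ?P \<subseteq> id -` (\<Inter>n. S n)"
      by (simp add: P top)
  qed
  moreover have top_eq: "topspace ?P = topspace ?Q"
    by (simp add: P top topspace_pullback_topology)
  \<comment> \<open>For equal carriers, continuity of the identity means inclusion of the families
    of open sets; the two directions give equality.\<close>
  ultimately have "openin ?P U \<longleftrightarrow> openin ?Q U" for U
    unfolding topology_finer_continuous_id[OF top_eq, symmetric]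
      topology_finer_continuous_id[OF top_eq[symmetric], symmetric]
    by iprover
  then show ?thesis
    by (simp add: topology_eq)
qed

text \<open>Since \<open>f\<close> preserves distances, balls of \<open>d\<close> are the traces on
  \<open>S\<close> of preimages of balls around image points.\<close>

lemma mtopology_eq_pullback_topology:
  fixes f :: "'a \<Rightarrow> 'b::metric_space"
  assumes "Metric_space S d"
    and d: "\<And>x y. x \<in> S \<Longrightarrow> y \<in> S \<Longrightarrow> d x y = dist (f x) (f y)"
  shows "Metric_space.mtopology S d = pullback_topology S f euclidean"
proof -
  interpret Metric_space S d by fact
  have "openin mtopology U \<longleftrightarrow> (\<exists>V. open V \<and> U = f -` V \<inter> S)" for U
  proof
    assume U: "openin mtopology U"
    then obtain r where r: "\<And>x. x \<in> U \<Longrightarrow> r x > 0 \<and> mball x (r x) \<subseteq> U" and "U \<subseteq> S"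
      unfolding openin_mtopology by metis
    have "U = f -` (\<Union>x\<in>U. ball (f x) (r x)) \<inter> S"
    proof (intro equalityI subsetI)
      fix y assume "y \<in> U"
      then show "y \<in> f -` (\<Union>x\<in>U. ball (f x) (r x)) \<inter> S"
        using r \<open>U \<subseteq> S\<close> by force
    next
      fix y assume "y \<in> f -` (\<Union>x\<in>U. ball (f x) (r x)) \<inter> S"
      then obtain x where "x \<in> U" "y \<in> mball x (r x)"
        using d \<open>U \<subseteq> S\<close> by (auto simp: subset_iff)
      then show "y \<in> U"
        using r by blast
    qed
    then show "\<exists>V. open V \<and> U = f -` V \<inter> S"
      by (metis open_UN open_ball)
  next
    assume "\<exists>V. open V \<and> U = f -` V \<inter> S"
    then obtain V where V: "open V" "U = f -` V \<inter> S" by blast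
    have "\<exists>r>0. mball x r \<subseteq> U" if "x \<in> U" for x
    proof -
      obtain r where "r > 0" "ball (f x) r \<subseteq> V"
        using openE[OF V(1), of "f x"] V(2) \<open>x \<in> U\<close> by blast
      have "mball x r \<subseteq> U"
      proof
        fix y assume y: "y \<in> mball x r"
        then have "dist (f x) (f y) < r" "y \<in> S"
          using d by auto
        then show "y \<in> U"
          using \<open>ball (f x) r \<subseteq> V\<close> V(2) by auto
      qed
      with \<open>r > 0\<close> show ?thesis
        by blast
    qed
    then show "openin mtopology U"
      using V by (auto simp: openin_mtopology)
  qed
  then show ?thesis
    by (simp add: topology_eq openin_pullback_topology)
qed

lemma mcomplete_closed_image:
  fixes f :: "'a \<Rightarrow> 'b::complete_space"
  assumes "Metric_space S d"
    and d: "\<And>x y. x \<in> S \<Longrightarrow> y \<in> S \<Longrightarrow> d x y = dist (f x) (f y)"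
    and "closed (f ` S)"
  shows "Metric_space.mcomplete S d"
proof -
  interpret Metric_space S d by fact
  show ?thesis
    unfolding mcomplete_def
  proof (intro allI impI)
    fix \<sigma> assume \<sigma>: "MCauchy \<sigma>"
    then have S: "\<sigma> n \<in> S" for n by (auto simp: MCauchy_def)
    have "Cauchy (\<lambda>n. f (\<sigma> n))"
      using \<sigma> S by (simp add: MCauchy_def Cauchy_def d)
    then obtain h where h: "(\<lambda>n. f (\<sigma> n)) \<longlonglongrightarrow> h"
      using Cauchy_convergent convergent_def by blast
    have "h \<in> f ` S"
      by (rule closed_sequentially[OF assms(3) _ h]) (use S in auto)
    then obtain l where "l \<in> S" "h = f l" by blast
    with h S show "\<exists>x. limitin mtopology \<sigma> x sequentially"
      by (auto simp: mtopology_eq_pullback_topology[OF assms(1) d] limitin_pullback_topology o_def)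
  qed
qed

section \<open>Countable products: convex boxes, translation invariance, coordinatewise
  limits\<close>

lemma open_fun_contains_convex:
  fixes W :: "(nat \<Rightarrow> 'a::real_normed_vector) set"
  assumes "open W" "h \<in> W"
  obtains X where "h \<in> Pi\<^sub>E UNIV X" "open (Pi\<^sub>E UNIV X)" "Pi\<^sub>E UNIV X \<subseteq> W" "\<And>i. convex (X i)"
proof -
  have "openin (product_topology (\<lambda>i. euclidean) UNIV) W"
    using assms by (simp add: euclidean_product_topology)
  from product_topology_open_contains_basis[OF this \<open>h \<in> W\<close>]
  obtain Y where Y: "h \<in> Pi\<^sub>E UNIV Y" "\<And>i. open (Y i)" "finite {i. Y i \<noteq> UNIV}" "Pi\<^sub>E UNIV Y \<subseteq> W"
    by auto
  \<comment> \<open>Restricted factors shrink to balls, which are convex. The last clause leaves the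
    other factors whole, so only finitely many are restricted and the new box is still open.\<close>
  have "\<exists>Z. open Z \<and> convex Z \<and> h i \<in> Z \<and> Z \<subseteq> Y i \<and> (Y i = UNIV \<longrightarrow> Z = UNIV)" for i
  proof (cases "Y i = UNIV")
    case False
    have "h i \<in> Y i" using Y(1) by auto
    then obtain e where "e > 0" "ball (h i) e \<subseteq> Y i"
      using openE[OF Y(2)] by blast
    then show ?thesis using False by (intro exI[of _ "ball (h i) e"]) auto
  qed auto
  then obtain X where X: "\<And>i. open (X i) \<and> convex (X i) \<and> h i \<in> X i \<and> X i \<subseteq> Y i \<and> (Y i = UNIV \<longrightarrow> X i = UNIV)"
    by metis
  show thesis
  proof
    show "open (Pi\<^sub>E UNIV X)"
      using X Y(3) by (intro open_PiE) (auto elim: rev_finite_subset)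
    show "Pi\<^sub>E UNIV X \<subseteq> W"
      using X Y(4) by (meson PiE_mono order_trans)
  qed (use X in auto)
qed

text \<open>The product metric is a weighted sum of truncated coordinate distances, each unchanged
  by a common translation.\<close>

lemma dist_fun_translation:
  fixes f g h :: "nat \<Rightarrow> 'a::real_normed_vector"
  shows "dist (\<lambda>n. f n + h n) (\<lambda>n. g n + h n) = dist f g"
  by (simp add: dist_fun_def)

lemma tendsto_fun_iff:
  fixes g :: "'b \<Rightarrow> nat \<Rightarrow> 'a::topological_space"
  shows "(g \<longlongrightarrow> l) F \<longleftrightarrow> (\<forall>n. ((\<lambda>x. g x n) \<longlongrightarrow> l n) F)"
  using limitin_componentwise[of "\<lambda>_::nat. euclidean :: 'a topology" UNIV g l F]
  by (simp add: euclidean_product_topology)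

section \<open>Generators of semigroups on Hausdorff spaces\<close>

lemma generator_eqI:
  assumes "Hausdorff_space \<tau>" "x \<in> topspace \<tau>"
    and lim: "limitin \<tau> (\<lambda>t. (1 / t) *\<^sub>R (T t x - x)) y (at_right 0)"
  shows "x \<in> generator_domain \<tau> T" "generator \<tau> T x = y"
proof -
  show "x \<in> generator_domain \<tau> T"
    using assms by (auto simp: generator_domain_def)
  show "generator \<tau> T x = y"
    unfolding generator_def using lim
    by (rule the_equality)
      (rule limitin_Hausdorff_unique[OF _ lim trivial_limit_at_right_real assms(1)])
qed

lemma generator_limitin:
  assumes "Hausdorff_space \<tau>" "x \<in> generator_domain \<tau> T"
  shows "limitin \<tau> (\<lambda>t. (1 / t) *\<^sub>R (T t x - x)) (generator \<tau> T x) (at_right 0)"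
  using assms generator_eqI(2)[of \<tau> x T] by (auto simp: generator_domain_def)

section \<open>The generator, its inverse and their relation to the semigroup\<close>

locale invertible_generator = normed_space_over smul
  for smul :: "'k::real_normed_field \<Rightarrow> 'a::banach \<Rightarrow> 'a" +
  fixes T :: "real \<Rightarrow> 'a \<Rightarrow> 'a"
  assumes semigroup: "strongly_continuous_semigroup smul euclidean T"
    and resolvent: "0 \<in> resolvent_set smul (generator_domain euclidean T) (generator euclidean T)"
begin

abbreviation "D \<equiv> generator_domain euclidean T"
abbreviation "A \<equiv> generator euclidean T"
abbreviation "X \<equiv> interpolation_space T"
abbreviation "X_inf \<equiv> limit_space T"
abbreviation "\<tau> \<equiv> limit_topology T"

text \<open>The resolvent condition at \<open>0\<close> inverts \<open>- A\<close>; the sign change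
  in the argument turns this into the inverse of \<open>A\<close>.\<close>

definition B :: "'a \<Rightarrow> 'a" where
  "B y = inv_into D (\<lambda>x. smul 0 x - A x) (- y)"

lemma minus_A_bij: "bij_betw (\<lambda>x. smul 0 x - A x) D UNIV"
  and inv_op: "inv_into D (\<lambda>x. smul 0 x - A x) \<in> continuous_linear_operators smul euclidean"
  using resolvent by (auto simp: resolvent_set_def)

lemma B_in_D [simp]: "B y \<in> D"
  unfolding B_def using minus_A_bij by (metis UNIV_I bij_betw_imp_surj_on inv_into_into)

lemma A_B [simp]: "A (B y) = y"
  using bij_betw_inv_into_right[OF minus_A_bij, of "- y"] by (simp add: B_def)

lemma B_A [simp]: "x \<in> D \<Longrightarrow> B (A x) = x"
  using bij_betw_inv_into_left[OF minus_A_bij, of x] by (simp add: B_def)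

lemma B_add: "B (x + y) = B x + B y"
  using inv_op unfolding continuous_linear_operators_def B_def by (metis (mono_tags, lifting) UNIV_I
    mem_Collect_eq minus_add_distrib topspace_euclidean)

lemma B_smul: "B (smul c x) = smul c (B x)"
  using inv_op unfolding continuous_linear_operators_def B_def
  by (metis (mono_tags, lifting) UNIV_I mem_Collect_eq scale_minus_right topspace_euclidean)

lemma continuous_on_B: "continuous_on UNIV B"
proof -
  have "continuous_on UNIV (inv_into D (\<lambda>x. smul 0 x - A x))"
    using inv_op by (simp add: continuous_linear_operators_def)
  then show ?thesis
    unfolding B_def by (rule continuous_on_compose2) (auto intro: continuous_intros)
qed

lemma T_add: "t \<ge> 0 \<Longrightarrow> T t (x + y) = T t x + T t y"
  and T_smul: "t \<ge> 0 \<Longrightarrow> T t (smul c x) = smul c (T t x)"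
  and continuous_on_T: "t \<ge> 0 \<Longrightarrow> continuous_on UNIV (T t)"
  and T_0: "T 0 x = x"
  and T_plus: "t \<ge> 0 \<Longrightarrow> s \<ge> 0 \<Longrightarrow> T (t + s) x = T t (T s x)"
  and continuous_on_orbit: "continuous_on {0..} (\<lambda>t. T t x)"
  using semigroup
  by (auto simp: strongly_continuous_semigroup_def continuous_linear_operators_def)

lemma T_scaleR: "t \<ge> 0 \<Longrightarrow> T t (r *\<^sub>R x) = r *\<^sub>R T t x"
  by (metis T_smul smul_of_real)

lemma T_diff: "t \<ge> 0 \<Longrightarrow> T t (x - y) = T t x - T t y"
  by (metis T_add add_diff_cancel diff_add_cancel)

lemma A_tendsto: "x \<in> D \<Longrightarrow> ((\<lambda>t. (1 / t) *\<^sub>R (T t x - x)) \<longlongrightarrow> A x) (at_right 0)"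
  using generator_limitin[of euclidean x T] by simp

text \<open>By continuity \<open>T s\<close> may be applied to the limit of difference quotients,
  and it commutes with them because \<open>T s\<close> is linear and commutes with
  \<open>T t\<close>.\<close>

lemma D_invariant:
  assumes "x \<in> D" "s \<ge> 0"
  shows "T s x \<in> D" "A (T s x) = T s (A x)"
proof -
  have "((\<lambda>t. T s ((1 / t) *\<^sub>R (T t x - x))) \<longlongrightarrow> T s (A x)) (at_right 0)"
    using continuous_on_T[OF assms(2)]
    by (intro isCont_tendsto_compose[OF _ A_tendsto[OF assms(1)]])
      (simp add: continuous_on_eq_continuous_at)
  moreover have "\<forall>\<^sub>F t in at_right 0. T s ((1 / t) *\<^sub>R (T t x - x)) = (1 / t) *\<^sub>R (T t (T s x) - T s x)"
    using eventually_at_right_less[of "0::real"]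
    by eventually_elim (use assms in \<open>simp add: T_scaleR T_diff add.commute flip: T_plus\<close>)
  ultimately have "((\<lambda>t. (1 / t) *\<^sub>R (T t (T s x) - T s x)) \<longlongrightarrow> T s (A x)) (at_right 0)"
    by (rule Lim_transform_eventually)
  then show "T s x \<in> D" "A (T s x) = T s (A x)"
    using generator_eqI[of euclidean "T s x" T "T s (A x)"] by auto
qed

text \<open>Linearity is inherited from the inverse: \<open>D\<close> is the range of the additive
  map \<open>B\<close>, and \<open>A\<close> undoes \<open>B\<close>.\<close>

lemma D_add: "x \<in> D \<Longrightarrow> y \<in> D \<Longrightarrow> x + y \<in> D \<and> A (x + y) = A x + A y"
  by (metis A_B B_A B_add B_in_D)

lemma D_smul: "x \<in> D \<Longrightarrow> smul c x \<in> D \<and> A (smul c x) = smul c (A x)"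
  by (metis A_B B_A B_smul B_in_D)

section \<open>Powers of the generator and the interpolation spaces\<close>

lemma X_0 [simp]: "X 0 = UNIV"
  by (simp add: interpolation_space_def)

text \<open>Separating the condition for \<open>k = 0\<close> peels off the innermost
  \<open>A\<close>. Together with \<open>A_pow_Suc\<close> this drives the inductions on
  \<open>n\<close> below, which therefore generalize over \<open>x\<close>.\<close>

lemma X_Suc: "X (Suc n) = {x \<in> D. A x \<in> X n}"
  by (auto simp: interpolation_space_def less_Suc_eq_0_disj funpow_swap1)

lemma A_pow_Suc: "(A ^^ Suc n) x = (A ^^ n) (A x)"
  by (simp add: funpow_swap1)

lemma X_zero: "0 \<in> X n"
  using D_smul[of "B 0" 0] by (induction n) (auto simp: X_Suc)

lemma X_add: "x \<in> X n \<Longrightarrow> y \<in> X n \<Longrightarrow> x + y \<in> X n \<and> (A ^^ n) (x + y) = (A ^^ n) x + (A ^^ n) y"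
  by (induction n arbitrary: x y) (auto simp: X_Suc A_pow_Suc D_add simp del: funpow.simps(2))

lemma X_smul: "x \<in> X n \<Longrightarrow> smul c x \<in> X n \<and> (A ^^ n) (smul c x) = smul c ((A ^^ n) x)"
  by (induction n arbitrary: x) (auto simp: X_Suc A_pow_Suc D_smul simp del: funpow.simps(2))

lemma X_scaleR: "x \<in> X n \<Longrightarrow> r *\<^sub>R x \<in> X n \<and> (A ^^ n) (r *\<^sub>R x) = r *\<^sub>R (A ^^ n) x"
  using X_smul[of x n "of_real r"] by (simp add: smul_of_real)

lemma X_minus: "x \<in> X n \<Longrightarrow> - x \<in> X n \<and> (A ^^ n) (- x) = - (A ^^ n) x"
  using X_scaleR[of x n "-1"] by simp

lemma X_diff: "x \<in> X n \<Longrightarrow> y \<in> X n \<Longrightarrow> x - y \<in> X n \<and> (A ^^ n) (x - y) = (A ^^ n) x - (A ^^ n) y"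
  using X_add[of x n "- y"] X_minus[of y n] by simp

lemma X_T: "x \<in> X n \<Longrightarrow> t \<ge> 0 \<Longrightarrow> T t x \<in> X n \<and> (A ^^ n) (T t x) = T t ((A ^^ n) x)"
  by (induction n arbitrary: x) (auto simp: X_Suc A_pow_Suc D_invariant simp del: funpow.simps(2))

text \<open>This is the definiteness of the norm on \<open>X n\<close>; each factor \<open>A\<close>
  is cancelled by its left inverse \<open>B\<close>.\<close>

lemma A_pow_inj: "x \<in> X n \<Longrightarrow> y \<in> X n \<Longrightarrow> (A ^^ n) x = (A ^^ n) y \<Longrightarrow> x = y"
proof (induction n arbitrary: x y)
  case (Suc n)
  then have "A x = A y"
    by (auto simp: X_Suc A_pow_Suc simp del: funpow.simps(2))
  then show ?case
    using Suc.prems by (metis (mono_tags, lifting) B_A X_Suc mem_Collect_eq)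
qed simp

lemma Metric_space_X: "Metric_space (X n) (\<lambda>x y. interpolation_norm T n (x - y))"
proof
  fix x y
  \<comment> \<open>Symmetry is demanded for all \<open>x\<close> and \<open>y\<close>, also off the
    carrier: \<open>x - y\<close> and \<open>y - x\<close> must receive the default value
    \<open>0\<close> simultaneously.\<close>
  have "- z \<in> X n \<longleftrightarrow> z \<in> X n" for z
    using X_minus[of z n] X_minus[of "- z" n] by auto
  then show "interpolation_norm T n (x - y) = interpolation_norm T n (y - x)"
    using X_minus[of "x - y" n] unfolding interpolation_norm_def
    by (metis minus_diff_eq norm_minus_cancel)
  show "x \<in> X n \<Longrightarrow> y \<in> X n \<Longrightarrow> interpolation_norm T n (x - y) = 0 \<longleftrightarrow> x = y"
    using A_pow_inj[of x n y] by (auto simp: interpolation_norm_def X_diff)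
next
  fix x y z assume "x \<in> X n" "y \<in> X n" "z \<in> X n"
  then show "interpolation_norm T n (x - z) \<le> interpolation_norm T n (x - y) + interpolation_norm T n (y - z)"
    using norm_triangle_ineq[of "(A ^^ n) x - (A ^^ n) y" "(A ^^ n) y - (A ^^ n) z"]
    by (simp add: interpolation_norm_def X_diff)
qed (simp add: interpolation_norm_def)

text \<open>By linearity of \<open>A ^^ n\<close> on \<open>X n\<close>, the distance there is the
  norm distance of the images.\<close>

lemma interpolation_topology_eq:
  "interpolation_topology T n = pullback_topology (X n) (A ^^ n) euclidean"
  unfolding interpolation_topology_def
  by (rule mtopology_eq_pullback_topology[OF Metric_space_X])
    (simp add: interpolation_norm_def X_diff dist_norm)

lemma Hausdorff_interpolation_topology: "Hausdorff_space (interpolation_topology T n)"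
  unfolding interpolation_topology_def
  by (rule Metric_space.Hausdorff_space_mtopology[OF Metric_space_X])

lemma topspace_interpolation_topology: "topspace (interpolation_topology T n) = X n"
  by (simp add: interpolation_topology_eq topspace_pullback_topology)

section \<open>The limit space as a closed part of a countable product\<close>

lemma X_inf_iff: "x \<in> X_inf \<longleftrightarrow> (\<forall>n. x \<in> X n)"
  by (simp add: limit_space_def)

definition \<Phi> :: "'a \<Rightarrow> nat \<Rightarrow> 'a" where
  "\<Phi> x n = (A ^^ n) x"

lemma limit_topology_eq: "\<tau> = pullback_topology X_inf \<Phi> euclidean"
  unfolding limit_topology_def interpolation_topology_eq[abs_def] limit_space_def \<Phi>_def[abs_def]
  by (rule projective_limit_topology_pullback)

lemma topspace_limit_topology: "topspace \<tau> = X_inf"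
  by (simp add: limit_topology_eq topspace_pullback_topology)

lemma limitin_limit_topology:
  "limitin \<tau> g l F \<longleftrightarrow> l \<in> X_inf \<and> eventually (\<lambda>x. g x \<in> X_inf) F \<and>
     (\<forall>n. ((\<lambda>x. (A ^^ n) (g x)) \<longlongrightarrow> (A ^^ n) l) F)"
  unfolding limit_topology_eq limitin_pullback_topology limitin_canonical_iff tendsto_fun_iff
    \<Phi>_def o_apply ..

text \<open>The universal property of the projective limit: a map into \<open>X_inf\<close> is
  continuous as soon as all its coordinates \<open>A ^^ n\<close> are.\<close>

lemma continuous_map_limit_topology:
  assumes "\<And>x. x \<in> topspace \<sigma> \<Longrightarrow> g x \<in> X_inf"
    and "\<And>n. continuous_map \<sigma> euclidean (\<lambda>x. (A ^^ n) (g x))"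
  shows "continuous_map \<sigma> \<tau> g"
  unfolding limit_topology_eq
proof (rule continuous_map_pullback')
  show "continuous_map \<sigma> euclidean (\<Phi> \<circ> g)"
    using assms(2)
    by (simp flip: euclidean_product_topology add: continuous_map_componentwise_UNIV \<Phi>_def)
qed (use assms in auto)

lemma continuous_map_A_pow: "continuous_map \<tau> euclidean (A ^^ n)"
proof -
  have "continuous_map euclidean euclidean (\<lambda>h::nat \<Rightarrow> 'a. h n)"
    by simp
  then have "continuous_map \<tau> euclidean ((\<lambda>h. h n) \<circ> \<Phi>)"
    unfolding limit_topology_eq by (rule continuous_map_pullback)
  then show ?thesis
    by (simp add: o_def \<Phi>_def[abs_def])
qed

lemma A_inf: "x \<in> X_inf \<Longrightarrow> A x \<in> X_inf"
  by (metis (mono_tags, lifting) X_Suc X_inf_iff mem_Collect_eq)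

lemma X_inf_D: "x \<in> X_inf \<Longrightarrow> x \<in> D"
  by (metis (mono_tags, lifting) X_Suc X_inf_iff mem_Collect_eq)

lemma B_inf: "x \<in> X_inf \<Longrightarrow> B x \<in> X_inf"
  unfolding X_inf_iff
proof
  fix n assume "\<forall>n. x \<in> X n"
  then show "B x \<in> X n"
    by (cases n) (simp_all add: X_Suc)
qed

text \<open>The recurrence says that \<open>h\<close> is the orbit of \<open>h 0\<close> under
  \<open>A\<close>. Stating it through \<open>B\<close>, continuous and defined everywhere, makes
  closedness of the image immediate.\<close>

lemma image_\<Phi>: "\<Phi> ` X_inf = {h. \<forall>n. h n = B (h (Suc n))}"
proof (intro equalityI subsetI)
  fix h assume "h \<in> \<Phi> ` X_inf"
  then obtain x where x: "x \<in> X_inf" "h = \<Phi> x" by blast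
  have "(A ^^ n) x \<in> X_inf" for n
    by (induction n) (use x A_inf in auto)
  then show "h \<in> {h. \<forall>n. h n = B (h (Suc n))}"
    by (simp add: x \<Phi>_def X_inf_D)
next
  fix h assume "h \<in> {h. \<forall>n. h n = B (h (Suc n))}"
  then have h: "h n = B (h (Suc n))" for n by blast
  have A: "A (h n) = h (Suc n)" for n
    by (subst h) simp
  \<comment> \<open>All \<open>k\<close> are treated at once, since \<open>A\<close> moves
    \<open>h k\<close> to \<open>h (Suc k)\<close>; membership in \<open>D\<close> comes from the
    range of \<open>B\<close>.\<close>
  have "h k \<in> X n" for k n
    by (induction n arbitrary: k) (simp_all add: X_Suc A, metis B_in_D h)
  moreover have "(A ^^ n) (h 0) = h n" for n
    by (induction n) (simp_all add: A)
  ultimately show "h \<in> \<Phi> ` X_inf"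
    by (intro image_eqI[of _ _ "h 0"]) (auto simp: X_inf_iff \<Phi>_def)
qed

lemma closed_image_\<Phi>: "closed (\<Phi> ` X_inf)"
  unfolding image_\<Phi>
proof (intro closed_Collect_all closed_Collect_eq)
  show "continuous_on UNIV (\<lambda>h. B (h (Suc n)))" for n
    by (rule continuous_on_compose2[OF continuous_on_B]) auto
qed simp

lemma Metric_space_X_inf: "Metric_space X_inf (\<lambda>x y. dist (\<Phi> x) (\<Phi> y))"
proof
  fix x y
  \<comment> \<open>The zeroth coordinate recovers the point, so \<open>\<Phi>\<close> is
    injective.\<close>
  have "\<Phi> x 0 = x" "\<Phi> y 0 = y"
    by (simp_all add: \<Phi>_def)
  then show "dist (\<Phi> x) (\<Phi> y) = 0 \<longleftrightarrow> x = y"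
    by (metis dist_eq_0_iff)
qed (simp_all add: dist_commute dist_triangle)

lemma mtopology_X_inf: "Metric_space.mtopology X_inf (\<lambda>x y. dist (\<Phi> x) (\<Phi> y)) = \<tau>"
  by (simp add: mtopology_eq_pullback_topology[OF Metric_space_X_inf] limit_topology_eq)

lemma Hausdorff_limit_topology: "Hausdorff_space \<tau>"
  using Metric_space.Hausdorff_space_mtopology[OF Metric_space_X_inf] by (simp add: mtopology_X_inf)

section \<open>Linear structure and Frechet property of the limit space\<close>

lemma X_inf_add: "x \<in> X_inf \<Longrightarrow> y \<in> X_inf \<Longrightarrow> x + y \<in> X_inf"
  and X_inf_smul: "x \<in> X_inf \<Longrightarrow> smul c x \<in> X_inf"
  and X_inf_scaleR: "x \<in> X_inf \<Longrightarrow> r *\<^sub>R x \<in> X_inf"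
  and X_inf_diff: "x \<in> X_inf \<Longrightarrow> y \<in> X_inf \<Longrightarrow> x - y \<in> X_inf"
  and X_inf_T: "x \<in> X_inf \<Longrightarrow> t \<ge> 0 \<Longrightarrow> T t x \<in> X_inf"
  by (simp_all add: X_inf_iff X_add X_smul X_scaleR X_diff X_T)

text \<open>Provides joint continuity of scalar multiplication on the Banach space, which is then
  used in each coordinate of the limit.\<close>

lemma bounded_bilinear_smul: "bounded_bilinear smul"
proof
  show "smul (r *\<^sub>R c) x = r *\<^sub>R smul c x" for r c x
    by (simp add: scaleR_conv_of_real flip: smul_of_real)
  show "smul c (r *\<^sub>R x) = r *\<^sub>R smul c x" for r c x
    by (metis scale_left_commute smul_of_real)
  show "\<exists>K. \<forall>a b. norm (smul a b) \<le> norm a * norm b * K"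
    by (rule exI[of _ 1]) (simp add: norm_smul)
qed (simp_all add: scale_left_distrib scale_right_distrib)

lemma topological_vector_space_limit_topology: "topological_vector_space_on smul \<tau>"
  unfolding topological_vector_space_on_def topspace_limit_topology
proof (intro conjI)
  have "0 \<in> X_inf"
    by (simp add: X_inf_iff X_zero)
  then show "subspace X_inf"
    by (simp add: subspace_def X_inf_add X_inf_smul)
  show "continuous_map (prod_topology \<tau> \<tau>) \<tau> (\<lambda>(x, y). x + y)"
  proof (rule continuous_map_limit_topology)
    fix n
    have "continuous_map (prod_topology \<tau> \<tau>) euclidean (\<lambda>p. (A ^^ n) (fst p) + (A ^^ n) (snd p))"
      by (intro continuous_map_add continuous_map_compose[OF continuous_map_fst continuous_map_A_pow, unfolded o_def]
         continuous_map_compose[OF continuous_map_snd continuous_map_A_pow, unfolded o_def])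
    then show "continuous_map (prod_topology \<tau> \<tau>) euclidean (\<lambda>p. (A ^^ n) (case p of (x, y) \<Rightarrow> x + y))"
      by (rule continuous_map_eq) (auto simp: topspace_limit_topology X_inf_iff X_add)
  qed (auto simp: topspace_limit_topology X_inf_add)
  show "continuous_map (prod_topology euclidean \<tau>) \<tau> (\<lambda>(c, x). smul c x)"
  proof (rule continuous_map_limit_topology)
    fix n
    have "continuous_map (prod_topology euclidean \<tau>) euclidean (\<lambda>p. (fst p, (A ^^ n) (snd p)))"
      by (subst prod_topology_euclidean[symmetric], intro continuous_map_pairedI continuous_map_fst
          continuous_map_compose[OF continuous_map_snd continuous_map_A_pow, unfolded o_def])
    moreover have "continuous_map euclidean euclidean (\<lambda>p. smul (fst p) (snd p))"
      by (simp add: bounded_bilinear.continuous_on[OF bounded_bilinear_smul] continuous_on_fst continuous_on_snd)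
    ultimately have "continuous_map (prod_topology euclidean \<tau>) euclidean
        ((\<lambda>p. smul (fst p) (snd p)) \<circ> (\<lambda>p. (fst p, (A ^^ n) (snd p))))"
      by (rule continuous_map_compose)
    then have "continuous_map (prod_topology euclidean \<tau>) euclidean (\<lambda>p. smul (fst p) ((A ^^ n) (snd p)))"
      by (simp add: o_def)
    then show "continuous_map (prod_topology euclidean \<tau>) euclidean (\<lambda>p. (A ^^ n) (case p of (c, x) \<Rightarrow> smul c x))"
      by (rule continuous_map_eq) (auto simp: topspace_limit_topology X_inf_iff X_smul)
  qed (auto simp: topspace_limit_topology X_inf_smul)
qed

lemma locally_convex_limit_topology: "locally_convex_space smul \<tau>"
  unfolding locally_convex_space_def
proof (intro conjI allI impI)
  fix U assume "openin \<tau> U \<and> 0 \<in> U"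
  then obtain W where W: "open W" "U = \<Phi> -` W \<inter> X_inf" "\<Phi> 0 \<in> W" "0 \<in> X_inf"
    by (auto simp: limit_topology_eq openin_pullback_topology)
  obtain Y where Y: "\<Phi> 0 \<in> Pi\<^sub>E UNIV Y" "open (Pi\<^sub>E UNIV Y)" "Pi\<^sub>E UNIV Y \<subseteq> W" "\<And>i. convex (Y i)"
    using open_fun_contains_convex[OF W(1,3)] by metis
  \<comment> \<open>The preimage of a convex box is convex because every \<open>A ^^ n\<close> is
    real-linear on \<open>X n\<close>.\<close>
  define V where "V = \<Phi> -` Pi\<^sub>E UNIV Y \<inter> X_inf"
  have "convex V"
  proof (rule convexI)
    fix x y and u v :: real
    assume xy: "x \<in> V" "y \<in> V" and uv: "0 \<le> u" "0 \<le> v" "u + v = 1"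
    then have "x \<in> X n" "y \<in> X n" "(A ^^ n) x \<in> Y n" "(A ^^ n) y \<in> Y n" for n
      by (auto simp: V_def X_inf_iff \<Phi>_def)
    then have "u *\<^sub>R x + v *\<^sub>R y \<in> X n" "(A ^^ n) (u *\<^sub>R x + v *\<^sub>R y) \<in> Y n" for n
      using X_add[of "u *\<^sub>R x" n "v *\<^sub>R y"] X_scaleR[of x n u] X_scaleR[of y n v]
        convexD[OF Y(4) _ _ uv] by auto
    then show "u *\<^sub>R x + v *\<^sub>R y \<in> V"
      by (auto simp: V_def X_inf_iff \<Phi>_def)
  qed
  moreover have "openin \<tau> V"
    using Y(2) by (auto simp: V_def limit_topology_eq openin_pullback_topology)
  ultimately show "\<exists>V. openin \<tau> V \<and> 0 \<in> V \<and> convex V \<and> V \<subseteq> U"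
    using Y W by (intro exI[of _ V]) (auto simp: V_def)
qed (fact topological_vector_space_limit_topology Hausdorff_limit_topology)+

lemma frechet_limit_topology: "frechet_space smul \<tau>"
  unfolding frechet_space_def topspace_limit_topology
proof (intro conjI exI ballI)
  show "Metric_space.mcomplete X_inf (\<lambda>x y. dist (\<Phi> x) (\<Phi> y))"
    by (rule mcomplete_closed_image[OF Metric_space_X_inf _ closed_image_\<Phi>]) simp
  fix x y z assume "x \<in> X_inf" "y \<in> X_inf" "z \<in> X_inf"
  then have "\<Phi> (x + z) = (\<lambda>n. \<Phi> x n + \<Phi> z n)" "\<Phi> (y + z) = (\<lambda>n. \<Phi> y n + \<Phi> z n)"
    by (auto simp: \<Phi>_def X_inf_iff X_add)
  then show "dist (\<Phi> (x + z)) (\<Phi> (y + z)) = dist (\<Phi> x) (\<Phi> y)"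
    by (simp add: dist_fun_translation)
qed (fact locally_convex_limit_topology Metric_space_X_inf mtopology_X_inf)+

section \<open>The limit semigroup and its generator\<close>

lemma limit_semigroup_eq [simp]: "x \<in> X_inf \<Longrightarrow> limit_semigroup T t x = T t x"
  by (simp add: limit_semigroup_def)

text \<open>Since \<open>A ^^ n\<close> commutes with \<open>T t\<close> on \<open>X n\<close>,
  coordinate \<open>n\<close> of \<open>T t x\<close> is \<open>T t ((A ^^ n) x)\<close>, so both
  continuity claims reduce to the Banach space.\<close>

lemma strongly_continuous_limit_semigroup:
  "strongly_continuous_semigroup smul \<tau> (limit_semigroup T)"
  unfolding strongly_continuous_semigroup_def continuous_linear_operators_def topspace_limit_topology
proof (intro conjI allI impI ballI CollectI)
  fix t :: real assume t: "t \<ge> 0"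
  show "continuous_map \<tau> \<tau> (limit_semigroup T t)"
  proof (rule continuous_map_limit_topology)
    fix n
    have "continuous_map \<tau> euclidean (T t \<circ> (A ^^ n))"
      using continuous_map_A_pow continuous_on_T[OF t] by (intro continuous_map_compose) auto
    then show "continuous_map \<tau> euclidean (\<lambda>x. (A ^^ n) (limit_semigroup T t x))"
      by (rule continuous_map_eq) (use t in \<open>auto simp: topspace_limit_topology X_inf_iff X_T limit_semigroup_def\<close>)
  qed (use t in \<open>simp add: topspace_limit_topology X_inf_T\<close>)
next
  fix x assume x: "x \<in> X_inf"
  show "continuous_map (top_of_set {0..}) \<tau> (\<lambda>t. limit_semigroup T t x)"
  proof (rule continuous_map_limit_topology)
    fix n
    have "continuous_map (top_of_set {0..}) euclidean (\<lambda>t. T t ((A ^^ n) x))"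
      using continuous_on_orbit by simp
    then show "continuous_map (top_of_set {0..}) euclidean (\<lambda>t. (A ^^ n) (limit_semigroup T t x))"
      by (rule continuous_map_eq) (use x in \<open>auto simp: X_inf_iff X_T limit_semigroup_def\<close>)
  qed (use x in \<open>simp add: X_inf_T\<close>)
qed (simp_all add: X_inf_add X_inf_smul X_inf_T T_add T_smul T_0 T_plus)

lemma limit_generator:
  assumes "x \<in> X_inf"
  shows "x \<in> generator_domain \<tau> (limit_semigroup T)" "generator \<tau> (limit_semigroup T) x = A x"
proof -
  have lim: "limitin \<tau> (\<lambda>t. (1 / t) *\<^sub>R (limit_semigroup T t x - x)) (A x) (at_right 0)"
    unfolding limitin_limit_topology
  proof (intro conjI allI)
    show "\<forall>\<^sub>F t in at_right 0. (1 / t) *\<^sub>R (limit_semigroup T t x - x) \<in> X_inf"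
      using eventually_at_right_less[of "0::real"]
      by eventually_elim (use assms in \<open>simp add: X_inf_scaleR X_inf_diff X_inf_T\<close>)
    fix n
    \<comment> \<open>Order \<open>Suc n\<close> puts \<open>(A ^^ n) x\<close> into
      \<open>D\<close>, where the difference quotients converge; order \<open>n\<close> lets
      \<open>A ^^ n\<close> pass through them.\<close>
    have x: "x \<in> X (Suc n)" "x \<in> X n"
      using assms by (auto simp: X_inf_iff)
    then have "(A ^^ n) x \<in> D"
      by (simp add: interpolation_space_def)
    from A_tendsto[OF this]
    have "((\<lambda>t. (1 / t) *\<^sub>R (T t ((A ^^ n) x) - (A ^^ n) x)) \<longlongrightarrow> (A ^^ n) (A x)) (at_right 0)"
      by (simp add: funpow_swap1)
    moreover have "\<forall>\<^sub>F t in at_right 0. (1 / t) *\<^sub>R (T t ((A ^^ n) x) - (A ^^ n) x) =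
        (A ^^ n) ((1 / t) *\<^sub>R (limit_semigroup T t x - x))"
      using eventually_at_right_less[of "0::real"]
      by eventually_elim (use assms x in \<open>simp add: X_scaleR X_diff X_T\<close>)
    ultimately show "((\<lambda>t. (A ^^ n) ((1 / t) *\<^sub>R (limit_semigroup T t x - x))) \<longlongrightarrow> (A ^^ n) (A x)) (at_right 0)"
      by (rule Lim_transform_eventually)
  qed (use assms A_inf in auto)
  then show "x \<in> generator_domain \<tau> (limit_semigroup T)" "generator \<tau> (limit_semigroup T) x = A x"
    using generator_eqI[OF Hausdorff_limit_topology] assms topspace_limit_topology by blast+
qed

lemma limit_generator_domain: "generator_domain \<tau> (limit_semigroup T) = X_inf"
  using limit_generator(1) by (auto simp: generator_domain_def topspace_limit_topology)

lemma continuous_map_limit_generator: "continuous_map \<tau> \<tau> (generator \<tau> (limit_semigroup T))"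
proof (rule continuous_map_limit_topology)
  show "continuous_map \<tau> euclidean (\<lambda>x. (A ^^ n) (generator \<tau> (limit_semigroup T) x))" for n
    \<comment> \<open>The generator acts as a shift: coordinate \<open>n\<close> of the image is
      coordinate \<open>Suc n\<close> of the argument.\<close>
    by (rule continuous_map_eq[OF continuous_map_A_pow[of "Suc n"]])
      (simp add: topspace_limit_topology limit_generator funpow_swap1)
qed (simp add: topspace_limit_topology limit_generator A_inf)

lemma continuous_map_B: "continuous_map \<tau> \<tau> B"
proof (rule continuous_map_limit_topology)
  fix n
  show "continuous_map \<tau> euclidean (\<lambda>x. (A ^^ n) (B x))"
  \<comment> \<open>For positive \<open>n\<close> the map \<open>B\<close> shifts coordinates down
    by one. Coordinate \<open>0\<close> is \<open>B x\<close> itself and needs the continuity of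
    \<open>B\<close> on the Banach space.\<close>
  proof (cases n)
    case 0
    then show ?thesis
      using continuous_map_compose[OF continuous_map_A_pow[of 0], of euclidean B] continuous_on_B
      by (simp add: o_def)
  next
    case (Suc m)
    then show ?thesis
      using continuous_map_A_pow[of m] by (simp add: funpow_swap1)
  qed
qed (simp add: topspace_limit_topology B_inf)

lemma limit_generator_linear:
  "generator \<tau> (limit_semigroup T) \<in> continuous_linear_operators smul \<tau>"
  using continuous_map_limit_generator
  by (simp add: continuous_linear_operators_def topspace_limit_topology limit_generator
      X_inf_add X_inf_smul D_add D_smul X_inf_D)

lemma homeomorphic_map_limit_generator: "homeomorphic_map \<tau> \<tau> (generator \<tau> (limit_semigroup T))"
proof (rule homeomorphic_maps_imp_map)
  show "homeomorphic_maps \<tau> \<tau> (generator \<tau> (limit_semigroup T)) B"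
    using continuous_map_limit_generator continuous_map_B
    by (simp add: homeomorphic_maps_def topspace_limit_topology limit_generator B_inf X_inf_D)
qed

text \<open>Convergence of the difference quotients in the limit space includes convergence in each
  coordinate, and coordinate \<open>n\<close> alone decides convergence in
  \<open>X n\<close>.\<close>

lemma interpolation_generator:
  assumes "x \<in> X_inf"
  shows "x \<in> generator_domain (interpolation_topology T n) (interpolation_semigroup T n)"
    and "generator (interpolation_topology T n) (interpolation_semigroup T n) x = A x"
proof -
  have x: "x \<in> X n" using assms by (simp add: X_inf_iff)
  have "limitin \<tau> (\<lambda>t. (1 / t) *\<^sub>R (limit_semigroup T t x - x)) (A x) (at_right 0)"
    using generator_limitin[OF Hausdorff_limit_topology limit_generator(1)[OF assms]]
      limit_generator(2)[OF assms] by simp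
  then have "limitin (interpolation_topology T n)
      (\<lambda>t. (1 / t) *\<^sub>R (interpolation_semigroup T n t x - x)) (A x) (at_right 0)"
    using x assms
    by (auto simp: limitin_limit_topology interpolation_topology_eq limitin_pullback_topology o_def
        interpolation_semigroup_def X_inf_iff elim: eventually_mono)
  then show "x \<in> generator_domain (interpolation_topology T n) (interpolation_semigroup T n)"
    and "generator (interpolation_topology T n) (interpolation_semigroup T n) x = A x"
    using generator_eqI[OF Hausdorff_interpolation_topology] x topspace_interpolation_topology
    by blast+
qed

end

theorem theoremB:
  fixes smul :: "'k::real_normed_field \<Rightarrow> 'a::banach \<Rightarrow> 'a"
    and T :: "real \<Rightarrow> 'a \<Rightarrow> 'a"
  assumes "normed_space_over smul"
    and "strongly_continuous_semigroup smul euclidean T"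
    and "0 \<in> resolvent_set smul (generator_domain euclidean T) (generator euclidean T)"
  shows
    "topspace (limit_topology T) = limit_space T \<and>
     frechet_space smul (limit_topology T) \<and>
     strongly_continuous_semigroup smul (limit_topology T) (limit_semigroup T) \<and>
     generator_domain (limit_topology T) (limit_semigroup T) = limit_space T \<and>
     generator (limit_topology T) (limit_semigroup T)
       \<in> continuous_linear_operators smul (limit_topology T) \<and>
     homeomorphic_map (limit_topology T) (limit_topology T)
       (generator (limit_topology T) (limit_semigroup T)) \<and>
     (\<forall>n\<ge>1.
        (\<forall>t\<ge>0. is_restriction_of (limit_space T) (limit_semigroup T t)
                  (interpolation_space T n) (interpolation_semigroup T n t)) \<and>
        is_restriction_of
          (generator_domain (limit_topology T) (limit_semigroup T))
          (generator (limit_topology T) (limit_semigroup T))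
          (generator_domain (interpolation_topology T n) (interpolation_semigroup T n))
          (generator (interpolation_topology T n) (interpolation_semigroup T n)))"
proof -
  interpret invertible_generator smul T
    using assms by (simp add: invertible_generator_def invertible_generator_axioms_def)
  show ?thesis
    by (auto simp: is_restriction_of_def topspace_limit_topology frechet_limit_topology
        strongly_continuous_limit_semigroup limit_generator_domain limit_generator_linear
        homeomorphic_map_limit_generator limit_generator interpolation_generator
        X_inf_iff interpolation_semigroup_def)
qed

end
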